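(* (a) Let $A=(D,\sigma,d)$, $d\in D^\times$, be a nonassociative generalized cyclic Azumaya algebra. Let $k\in C$ be such that there is $c\in C^\times$ with $k=c^{-1}\sigma(c)$. (i) For $\tau\in\mathrm{Aut}_{S_0}(D)$ commuting with $\sigma$, $H_{\tau,k}=G_c\circ H_{\tau,1}$ as maps on $A$ (here $H_{\tau,1}$ is not necessarily an automorphism, just a map). (ii) The automorphism $H_{id,k}$ of $A$ is the inner automorphism $$G_c\Big(\sum_{i=0}^{m-1}a_it^i\Big)=\Big(c^{-1}\sum_{i=0}^{m-1}a_it^i\Big)c .$$ (b) Let $A=(S/S_0,\sigma,d)$, $d\in S^\times$, be a nonassociative cyclic Azumaya algebra. Let $k\in S$ be such that there is $c\in S^\times$ with $k=c^{-1}\sigma(c)$. (i) For $\tau\in\mathrm{Aut}_{S_0}(S)$ commuting with $\sigma$, $H_{\tau,k}=G_c\circ H_{\tau,1}$ as maps on $A$ (again $H_{\tau,1}$ is not necessarily an automorphism, just a map). (ii) The automorphism $H_{id,k}$ of $A$ is the inner automorphism $$G_c\Big(\sum_{i=0}^{m-1}a_it^i\Big)=\Big(c^{-1}\sum_{i=0}^{m-1}a_it^i\Big)c .$$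
   Context: All rings are unital. $D$ is an Azumaya algebra with center $C$ (associative, finitely generated as a $C$-module, separable over $C$, center exactly $C$), of constant rank over $C$. $\sigma$ is a ring automorphism of $D$ such that $\sigma|_C$ has finite order $m\ge 2$; $\mathrm{Fix}(\sigma)=\{a\in D\mid\sigma(a)=a\}$ and $S_0=\mathrm{Fix}(\sigma)\cap C$. It is assumed that $C/S_0$ is a Galois extension of commutative rings (in the sense of Chase–Harrison–Rosenberg) with cyclic Galois group $\langle\sigma|_C\rangle$ of order $m$: $C$ is a faithfully projective $S_0$-module of constant rank $m$ and $C\otimes_{S_0}C\to\prod_{j=0}^{m-1}C$, $x\otimes y\mapsto (x\sigma^j(y))_j$, is an isomorphism. $D[t;\sigma]$ is the skew polynomial ring of left polynomials $\sum a_it^i$, $a_i\in D$, with $ta=\sigma(a)t$ for $a\in D$. For $d\in D^\times$ let $f(t)=t^m-d$. The nonassociative generalized cyclic Azumaya algebra $(D,\sigma,d)=D[t;\sigma]/D[t;\sigma]f$ is the additive group $\{g\in D[t;\sigma]\mid \deg g<m\}$ with multiplication $g\circ h$ = remainder of $gh$ under right division by $f$ (i.e. the unique $r$ with $gh=qf+r$, $\deg r<m$). It is a unital, not necessarily associative, $S_0$-algebra. When $D=C=S$ is commutative (so $S/S_0$ is a cyclic Galois extension of degree $m$ with group $\langle\sigma\rangle$), the algebra is written $(S/S_0,\sigma,d)$ and called a nonassociative cyclic Azumaya algebra. $\mathrm{Aut}_{S_0}$ denotes the group of $S_0$-algebra automorphisms. For $\tau\in\mathrm{Aut}_{S_0}(D)$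 and $k\in C^\times$, $H_{\tau,k}$ is the map $A\to A$, $$H_{\tau,k}\Big(\sum_{i=0}^{m-1}a_it^i\Big)=\tau(a_0)+\sum_{i=1}^{m-1}\tau(a_i)\Big(\prod_{l=0}^{i-1}\sigma^l(k)\Big)t^i .$$ For $c\in A$ with left inverse $c_l$, $G_c$ denotes the map $x\mapsto (c_lx)c$ on $A$; an automorphism of $A$ of this form is called inner. *)

theory Defs
  imports "HOL-Algebra.UnivPoly" "HOL-Algebra.QuotRing" "HOL-Algebra.Free_Abelian_Groups"
begin

definition center :: "('a, 'e) ring_scheme \<Rightarrow> 'a set"
  where "center D = {c \<in> carrier D. \<forall>x \<in> carrier D. c \<otimes>\<^bsub>D\<^esub> x = x \<otimes>\<^bsub>D\<^esub> c}"

abbreviation center_ring :: "('a, 'e) ring_scheme \<Rightarrow> ('a, 'e) ring_scheme"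
  where "center_ring D \<equiv> D\<lparr>carrier := center D\<rparr>"

definition fixed :: "('a, 'e) ring_scheme \<Rightarrow> ('a \<Rightarrow> 'a) \<Rightarrow> 'a set"
  where "fixed D \<sigma> = {a \<in> carrier D. \<sigma> a = a}"

abbreviation base_ring :: "('a, 'e) ring_scheme \<Rightarrow> ('a \<Rightarrow> 'a) \<Rightarrow> ('a, 'e) ring_scheme"
  where "base_ring D \<sigma> \<equiv> D\<lparr>carrier := fixed D \<sigma> \<inter> center D\<rparr>"

text \<open>
  A ring viewed as an algebra over any of its subrings, scalars acting by left multiplication.
  The ring of scalars is always passed as a separate argument.
\<close>

definition self_alg :: "('a, 'e) ring_scheme \<Rightarrow> ('a, 'a) module"
  where "self_alg A = \<lparr>carrier = carrier A, mult = mult A, one = one A, ring.zero = ring.zero A,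
    add = add A, smult = mult A\<rparr>"

text \<open>Linear maps between left modules; the ring of scalars need not be commutative.\<close>

definition linear_maps ::
  "('r, 'e) ring_scheme \<Rightarrow> ('r, 'a, 'f) module_scheme \<Rightarrow> ('r, 'b, 'g) module_scheme \<Rightarrow> ('a \<Rightarrow> 'b) set"
  where "linear_maps R M N = {h \<in> carrier M \<rightarrow> carrier N.
    (\<forall>x \<in> carrier M. \<forall>y \<in> carrier M. h (x \<oplus>\<^bsub>M\<^esub> y) = h x \<oplus>\<^bsub>N\<^esub> h y) \<and>
    (\<forall>r \<in> carrier R. \<forall>x \<in> carrier M. h (r \<odot>\<^bsub>M\<^esub> x) = r \<odot>\<^bsub>N\<^esub> h x)}"

text \<open>
  Automorphisms of a unital algebra; as \<open>ring_iso\<close> only refers to the operations of the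
  records, this also makes sense for nonassociative algebras.
\<close>

definition alg_auts :: "('r, 'e) ring_scheme \<Rightarrow> ('r, 'a, 'f) module_scheme \<Rightarrow> ('a \<Rightarrow> 'a) set"
  where "alg_auts R A = {h \<in> ring_iso A A.
    \<forall>r \<in> carrier R. \<forall>x \<in> carrier A. h (r \<odot>\<^bsub>A\<^esub> x) = r \<odot>\<^bsub>A\<^esub> h x}"

definition power_alg :: "('r, 'e) ring_scheme \<Rightarrow> nat \<Rightarrow> ('r, nat \<Rightarrow> 'r) module"
  where "power_alg R n = \<lparr>carrier = {..<n} \<rightarrow>\<^sub>E carrier R,
    mult = (\<lambda>x y. \<lambda>i\<in>{..<n}. x i \<otimes>\<^bsub>R\<^esub> y i),
    one = (\<lambda>i\<in>{..<n}. \<one>\<^bsub>R\<^esub>),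
    ring.zero = (\<lambda>i\<in>{..<n}. \<zero>\<^bsub>R\<^esub>),
    add = (\<lambda>x y. \<lambda>i\<in>{..<n}. x i \<oplus>\<^bsub>R\<^esub> y i),
    smult = (\<lambda>r x. \<lambda>i\<in>{..<n}. r \<otimes>\<^bsub>R\<^esub> x i)\<rparr>"

definition fin_gen :: "('r, 'e) ring_scheme \<Rightarrow> ('r, 'a, 'f) module_scheme \<Rightarrow> bool"
  where "fin_gen R M \<longleftrightarrow>
    (\<exists>n. \<exists>p \<in> linear_maps R (power_alg R n) M. p ` carrier (power_alg R n) = carrier M)"

text \<open>Finitely generated projective: a direct summand of some \<open>R\<^sup>n\<close>.\<close>

definition fg_projective :: "('r, 'e) ring_scheme \<Rightarrow> ('r, 'a, 'f) module_scheme \<Rightarrow> bool"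
  where "fg_projective R M \<longleftrightarrow>
    (\<exists>n. \<exists>j \<in> linear_maps R M (power_alg R n). \<exists>p \<in> linear_maps R (power_alg R n) M.
      \<forall>x \<in> carrier M. p (j x) = x)"

definition faithful :: "('r, 'e) ring_scheme \<Rightarrow> ('r, 'a, 'f) module_scheme \<Rightarrow> bool"
  where "faithful R M \<longleftrightarrow>
    (\<forall>r \<in> carrier R. (\<forall>x \<in> carrier M. r \<odot>\<^bsub>M\<^esub> x = \<zero>\<^bsub>M\<^esub>) \<longrightarrow> r = \<zero>\<^bsub>R\<^esub>)"

definition faithfully_projective :: "('r, 'e) ring_scheme \<Rightarrow> ('r, 'a, 'f) module_scheme \<Rightarrow> bool"
  where "faithfully_projective R M \<longleftrightarrow> fg_projective R M \<and> faithful R M"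

text \<open>
  Localization at a prime ideal \<open>P\<close> of \<open>R\<close>: \<open>fraction R P M x s\<close> is the fraction \<open>x/s\<close>, as a set of
  pairs (numerator, denominator).
\<close>

definition fraction :: "('r, 'e) ring_scheme \<Rightarrow> 'r set \<Rightarrow> ('r, 'a, 'f) module_scheme \<Rightarrow> 'a \<Rightarrow> 'r \<Rightarrow> ('a \<times> 'r) set"
  where "fraction R P M x s = {(y, t). y \<in> carrier M \<and> t \<in> carrier R - P \<and>
    (\<exists>u \<in> carrier R - P. u \<odot>\<^bsub>M\<^esub> (t \<odot>\<^bsub>M\<^esub> x) = u \<odot>\<^bsub>M\<^esub> (s \<odot>\<^bsub>M\<^esub> y))}"

definition localize :: "('r, 'e) ring_scheme \<Rightarrow> 'r set \<Rightarrow> ('r, 'a, 'f) module_scheme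
    \<Rightarrow> (('r \<times> 'r) set, ('a \<times> 'r) set) module"
  where "localize R P M = \<lparr>
    carrier = {fraction R P M x s |x s. x \<in> carrier M \<and> s \<in> carrier R - P},
    mult = (\<lambda>U V. \<Union>(x, s)\<in>U. \<Union>(y, t)\<in>V. fraction R P M (x \<otimes>\<^bsub>M\<^esub> y) (s \<otimes>\<^bsub>R\<^esub> t)),
    one = fraction R P M \<one>\<^bsub>M\<^esub> \<one>\<^bsub>R\<^esub>,
    ring.zero = fraction R P M \<zero>\<^bsub>M\<^esub> \<one>\<^bsub>R\<^esub>,
    add = (\<lambda>U V. \<Union>(x, s)\<in>U. \<Union>(y, t)\<in>V.
      fraction R P M ((t \<odot>\<^bsub>M\<^esub> x) \<oplus>\<^bsub>M\<^esub> (s \<odot>\<^bsub>M\<^esub> y)) (s \<otimes>\<^bsub>R\<^esub> t)),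
    smult = (\<lambda>U V. \<Union>(a, s)\<in>U. \<Union>(y, t)\<in>V. fraction R P M (a \<odot>\<^bsub>M\<^esub> y) (s \<otimes>\<^bsub>R\<^esub> t))\<rparr>"

definition free_of_rank :: "('r, 'e) ring_scheme \<Rightarrow> ('r, 'a, 'f) module_scheme \<Rightarrow> nat \<Rightarrow> bool"
  where "free_of_rank R M n \<longleftrightarrow>
    (\<exists>h \<in> linear_maps R M (power_alg R n). bij_betw h (carrier M) (carrier (power_alg R n)))"

definition constant_rank :: "('r, 'e) ring_scheme \<Rightarrow> ('r, 'a, 'f) module_scheme \<Rightarrow> nat \<Rightarrow> bool"
  where "constant_rank R M n \<longleftrightarrow>
    (\<forall>P. primeideal P R \<longrightarrow> free_of_rank (localize R P (self_alg R)) (localize R P M) n)"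

text \<open>
  The tensor product of two \<open>R\<close>-algebras: the free abelian group on pairs, modulo the subgroup
  generated by the bilinearity and balancing relations.
\<close>

definition tensor_relations :: "('r, 'e) ring_scheme \<Rightarrow> ('r, 'a, 'f) module_scheme
    \<Rightarrow> ('r, 'b, 'g) module_scheme \<Rightarrow> ('a \<times> 'b \<Rightarrow>\<^sub>0 int) set"
  where "tensor_relations R A B =
    {frag_of (x \<oplus>\<^bsub>A\<^esub> x', y) - frag_of (x, y) - frag_of (x', y) |x x' y.
      x \<in> carrier A \<and> x' \<in> carrier A \<and> y \<in> carrier B} \<union>
    {frag_of (x, y \<oplus>\<^bsub>B\<^esub> y') - frag_of (x, y) - frag_of (x, y') |x y y'.
      x \<in> carrier A \<and> y \<in> carrier B \<and> y' \<in> carrier B} \<union>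
    {frag_of (r \<odot>\<^bsub>A\<^esub> x, y) - frag_of (x, r \<odot>\<^bsub>B\<^esub> y) |r x y.
      r \<in> carrier R \<and> x \<in> carrier A \<and> y \<in> carrier B}"

definition tensor_coset :: "('r, 'e) ring_scheme \<Rightarrow> ('r, 'a, 'f) module_scheme
    \<Rightarrow> ('r, 'b, 'g) module_scheme \<Rightarrow> ('a \<times> 'b \<Rightarrow>\<^sub>0 int) \<Rightarrow> ('a \<times> 'b \<Rightarrow>\<^sub>0 int) set"
  where "tensor_coset R A B u =
    (let F = free_Abelian_group (carrier A \<times> carrier B)
     in generate F (tensor_relations R A B) #>\<^bsub>F\<^esub> u)"

definition pure_tensor :: "('r, 'e) ring_scheme \<Rightarrow> ('r, 'a, 'f) module_scheme
    \<Rightarrow> ('r, 'b, 'g) module_scheme \<Rightarrow> 'a \<Rightarrow> 'b \<Rightarrow> ('a \<times> 'b \<Rightarrow>\<^sub>0 int) set"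
  where "pure_tensor R A B x y = tensor_coset R A B (frag_of (x, y))"

definition tensor_mult :: "('r, 'a, 'f) module_scheme \<Rightarrow> ('r, 'b, 'g) module_scheme
    \<Rightarrow> ('a \<times> 'b \<Rightarrow>\<^sub>0 int) \<Rightarrow> ('a \<times> 'b \<Rightarrow>\<^sub>0 int) \<Rightarrow> ('a \<times> 'b \<Rightarrow>\<^sub>0 int)"
  where "tensor_mult A B u v =
    frag_extend (\<lambda>(x, y). frag_extend (\<lambda>(x', y'). frag_of (x \<otimes>\<^bsub>A\<^esub> x', y \<otimes>\<^bsub>B\<^esub> y')) v) u"

definition tensor :: "('r, 'e) ring_scheme \<Rightarrow> ('r, 'a, 'f) module_scheme
    \<Rightarrow> ('r, 'b, 'g) module_scheme \<Rightarrow> ('a \<times> 'b \<Rightarrow>\<^sub>0 int) set ring"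
  where "tensor R A B =
    (let F = free_Abelian_group (carrier A \<times> carrier B);
         Q = F Mod generate F (tensor_relations R A B)
     in \<lparr>carrier = carrier Q,
         mult = (\<lambda>U V. \<Union>u\<in>U. \<Union>v\<in>V. tensor_coset R A B (tensor_mult A B u v)),
         one = pure_tensor R A B \<one>\<^bsub>A\<^esub> \<one>\<^bsub>B\<^esub>,
         ring.zero = one Q,
         add = mult Q\<rparr>)"

definition opposite :: "('r, 'a) module \<Rightarrow> ('r, 'a) module"
  where "opposite A = A\<lparr>mult := (\<lambda>x y. y \<otimes>\<^bsub>A\<^esub> x)\<rparr>"

definition enveloping :: "('r, 'e) ring_scheme \<Rightarrow> ('r, 'a) module \<Rightarrow> ('a \<times> 'a \<Rightarrow>\<^sub>0 int) set ring"
  where "enveloping R A = tensor R A (opposite A)"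

text \<open>
  \<open>A\<close> as a left module over its enveloping algebra, \<open>(a \<otimes> b) x = a x b\<close>. The action of a class is
  computed on any of its representatives \<open>u = \<Sum> n\<^sub>i (a\<^sub>i, b\<^sub>i)\<close>.
\<close>

definition env_module :: "('r, 'a) module \<Rightarrow> (('a \<times> 'a \<Rightarrow>\<^sub>0 int) set, 'a) module"
  where "env_module A = \<lparr>carrier = carrier A, mult = mult A, one = one A, ring.zero = ring.zero A, add = add A,
    smult = (\<lambda>U x. the_elem ((\<lambda>u. \<Oplus>\<^bsub>A\<^esub>p\<in>Poly_Mapping.keys u.
      [Poly_Mapping.lookup u p] \<cdot>\<^bsub>A\<^esub> (fst p \<otimes>\<^bsub>A\<^esub> x \<otimes>\<^bsub>A\<^esub> snd p)) ` U))\<rparr>"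

text \<open>
  Separable: projective over the enveloping algebra. The module is cyclic (generated by \<open>1\<close>), so
  projective and finitely generated projective agree.
\<close>

definition separable :: "('r, 'e) ring_scheme \<Rightarrow> ('r, 'a) module \<Rightarrow> bool"
  where "separable R A \<longleftrightarrow> fg_projective (enveloping R A) (env_module A)"

definition azumaya :: "('a, 'e) ring_scheme \<Rightarrow> bool"
  where "azumaya D \<longleftrightarrow> ring D \<and> fin_gen (center_ring D) (self_alg D) \<and>
    separable (center_ring D) (self_alg D)"

definition restricted_order :: "('a \<Rightarrow> 'a) \<Rightarrow> 'a set \<Rightarrow> nat \<Rightarrow> bool"
  where "restricted_order \<sigma> X m \<longleftrightarrow> 0 < m \<and> (\<forall>x \<in> X. (\<sigma> ^^ m) x = x) \<and>
    (\<forall>n. 0 < n \<and> n < m \<longrightarrow> \<not> (\<forall>x \<in> X. (\<sigma> ^^ n) x = x))"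

definition cyclic_galois ::
  "('a, 'e) ring_scheme \<Rightarrow> ('a, 'f) ring_scheme \<Rightarrow> ('a \<Rightarrow> 'a) \<Rightarrow> nat \<Rightarrow> bool"
  where "cyclic_galois C R \<sigma> m \<longleftrightarrow>
    faithfully_projective R (self_alg C) \<and> constant_rank R (self_alg C) m \<and>
    (\<exists>\<phi> \<in> ring_iso (tensor R (self_alg C) (self_alg C)) (power_alg C m).
      \<forall>x \<in> carrier C. \<forall>y \<in> carrier C.
        \<phi> (pure_tensor R (self_alg C) (self_alg C) x y) = (\<lambda>j\<in>{..<m}. x \<otimes>\<^bsub>C\<^esub> (\<sigma> ^^ j) y))"

text \<open>
  Skew polynomials share everything but the multiplication with ordinary polynomials; the
  coefficient formula below comes from \<open>(a t\<^sup>i) (b t\<^sup>j) = a \<sigma>\<^sup>i(b) t\<^sup>i\<^sup>+\<^sup>j\<close>.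
\<close>

definition skew_poly :: "('a, 'e) ring_scheme \<Rightarrow> ('a \<Rightarrow> 'a) \<Rightarrow> ('a, nat \<Rightarrow> 'a) up_ring"
  where "skew_poly D \<sigma> = (UP D)\<lparr>mult := (\<lambda>p\<in>up D. \<lambda>q\<in>up D. \<lambda>n.
    \<Oplus>\<^bsub>D\<^esub>i \<in> {..n}. p i \<otimes>\<^bsub>D\<^esub> (\<sigma> ^^ i) (q (n - i)))\<rparr>"

definition cyclic_poly :: "('a, 'e) ring_scheme \<Rightarrow> ('a \<Rightarrow> 'a) \<Rightarrow> nat \<Rightarrow> 'a \<Rightarrow> nat \<Rightarrow> 'a"
  where "cyclic_poly D \<sigma> m d =
    (let P = skew_poly D \<sigma> in monom P \<one>\<^bsub>D\<^esub> m \<ominus>\<^bsub>P\<^esub> monom P d 0)"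

definition right_rem :: "('a, 'e) ring_scheme \<Rightarrow> ('a \<Rightarrow> 'a) \<Rightarrow> nat \<Rightarrow> 'a \<Rightarrow> (nat \<Rightarrow> 'a) \<Rightarrow> nat \<Rightarrow> 'a"
  where "right_rem D \<sigma> m d p = (let P = skew_poly D \<sigma> in
    THE r. r \<in> carrier P \<and> deg D r < m \<and>
      (\<exists>q \<in> carrier P. p = (q \<otimes>\<^bsub>P\<^esub> cyclic_poly D \<sigma> m d) \<oplus>\<^bsub>P\<^esub> r))"

definition cyclic_alg :: "('a, 'e) ring_scheme \<Rightarrow> ('a \<Rightarrow> 'a) \<Rightarrow> nat \<Rightarrow> 'a \<Rightarrow> ('a, nat \<Rightarrow> 'a) module"
  where "cyclic_alg D \<sigma> m d = (let P = skew_poly D \<sigma> in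
    \<lparr>carrier = {g \<in> carrier P. deg D g < m},
     mult = (\<lambda>g h. right_rem D \<sigma> m d (g \<otimes>\<^bsub>P\<^esub> h)),
     one = one P, ring.zero = ring.zero P, add = add P, smult = smult P\<rparr>)"

abbreviation const_poly :: "('a, 'e) ring_scheme \<Rightarrow> 'a \<Rightarrow> nat \<Rightarrow> 'a"
  where "const_poly D a \<equiv> monom (UP D) a 0"

definition H_map :: "('a, 'e) ring_scheme \<Rightarrow> ('a \<Rightarrow> 'a) \<Rightarrow> nat \<Rightarrow> ('a \<Rightarrow> 'a) \<Rightarrow> 'a \<Rightarrow> (nat \<Rightarrow> 'a) \<Rightarrow> nat \<Rightarrow> 'a"
  where "H_map D \<sigma> m \<tau> k g = (\<lambda>i.
    if i = 0 then \<tau> (g 0)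
    else if i < m then \<tau> (g i) \<otimes>\<^bsub>D\<^esub> (\<Otimes>\<^bsub>center_ring D\<^esub>l\<in>{..<i}. (\<sigma> ^^ l) k)
    else \<zero>\<^bsub>D\<^esub>)"

text \<open>
  In a nonassociative algebra left inverses need not be unique, so \<open>G_map\<close> takes the left inverse
  \<open>cl\<close> of \<open>c\<close> as an argument.
\<close>

definition G_map :: "('a, 'e) ring_scheme \<Rightarrow> 'a \<Rightarrow> 'a \<Rightarrow> 'a \<Rightarrow> 'a"
  where "G_map A cl c x = (cl \<otimes>\<^bsub>A\<^esub> x) \<otimes>\<^bsub>A\<^esub> c"

definition left_inverse :: "('a, 'e) ring_scheme \<Rightarrow> 'a \<Rightarrow> 'a \<Rightarrow> bool"
  where "left_inverse A cl c \<longleftrightarrow> cl \<in> carrier A \<and> c \<in> carrier A \<and> cl \<otimes>\<^bsub>A\<^esub> c = \<one>\<^bsub>A\<^esub>"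

definition inner_auts :: "('r, 'e) ring_scheme \<Rightarrow> ('r, 'a, 'f) module_scheme \<Rightarrow> ('a \<Rightarrow> 'a) set"
  where "inner_auts R A = {h \<in> alg_auts R A.
    \<exists>cl c. left_inverse A cl c \<and> (\<forall>x \<in> carrier A. h x = G_map A cl c x)}"

definition gen_cyclic_setting :: "('a, 'e) ring_scheme \<Rightarrow> ('a \<Rightarrow> 'a) \<Rightarrow> nat \<Rightarrow> bool"
  where "gen_cyclic_setting D \<sigma> m \<longleftrightarrow>
    azumaya D \<and> (\<exists>n. constant_rank (center_ring D) (self_alg D) n) \<and>
    \<sigma> \<in> ring_iso D D \<and> restricted_order \<sigma> (center D) m \<and> 2 \<le> m \<and>
    cyclic_galois (center_ring D) (base_ring D \<sigma>) \<sigma> m"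

text \<open>The commutative case: a commutative ring is its own center.\<close>

definition cyclic_setting :: "('a, 'e) ring_scheme \<Rightarrow> ('a \<Rightarrow> 'a) \<Rightarrow> nat \<Rightarrow> bool"
  where "cyclic_setting S \<sigma> m \<longleftrightarrow>
    cring S \<and> \<sigma> \<in> ring_iso S S \<and> restricted_order \<sigma> (carrier S) m \<and> 2 \<le> m \<and>
    cyclic_galois S (S\<lparr>carrier := fixed S \<sigma>\<rparr>) \<sigma> m"

end

theory Submission
  imports Defs
begin

text \<open>Put u_i = c^(-1) \<sigma>^i(c), so that u_1 = k. The product of the \<sigma>^l(k) over l
  < i telescopes to u_i (\<open>finprod_cocycle\<close>), so H_{\<tau>,k} sends a_i t^i to
  \<tau>(a_i) u_i t^i. Moving c to the left past t^i and using that c^(-1) is central, one gets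
  (c^(-1) a_i t^i) c = a_i u_i t^i; the degree stays below m, so no reduction takes place
  (\<open>G_map_eq\<close>). Comparing coefficients gives (i) and, for \<tau> = id, the formula in
  (ii).

  It remains to see that a_i |-> a_i u_i is an automorphism of A. On skew polynomials it is the
  substitution t |-> k t, which is multiplicative by the cocycle identity u_(i+l) = u_i
  \<sigma>^i(u_l) and the centrality of the u_i (\<open>rescale_skew_mult\<close>). It respects
  reduction modulo t^m - d because \<sigma>^m(c) = c makes u periodic with period m
  (\<open>rescale_mult\<close>), and it is bijective because each u_i is a unit. The product of A is
  a remainder given by a definite description; \<open>right_rem_unique\<close> and
  \<open>right_rem_eq\<close> replace it by an explicit formula. Part (b) is the same argument with
  D = C = S.\<close>

section \<open>One-term sums and the center as a commutative monoid\<close>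

context ring
begin

lemma finsum_eq_single:
  assumes "finite I" "i \<in> I" "g i \<in> carrier R" "\<And>l. l \<in> I \<Longrightarrow> l \<noteq> i \<Longrightarrow> g l = \<zero>"
  shows "(\<Oplus>l\<in>I. g l) = g i"
proof -
  have "(\<Oplus>l\<in>I. g l) = (\<Oplus>l\<in>I. if i = l then g l else \<zero>)"
    using assms by (intro add.finprod_cong') auto
  also have "\<dots> = g i"
    using assms by (intro add.finprod_singleton) (auto, metis zero_closed)
  finally show ?thesis .
qed

lemma center_closed: "x \<in> center R \<Longrightarrow> x \<in> carrier R"
  by (simp add: center_def)

lemma center_comm: "x \<in> center R \<Longrightarrow> y \<in> carrier R \<Longrightarrow> x \<otimes> y = y \<otimes> x"
  by (simp add: center_def)

lemma center_mult:
  assumes x: "x \<in> center R" and y: "y \<in> center R"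
  shows "x \<otimes> y \<in> center R"
proof -
  have "x \<otimes> y \<otimes> z = z \<otimes> (x \<otimes> y)" if z: "z \<in> carrier R" for z
  proof -
    have "x \<otimes> y \<otimes> z = x \<otimes> z \<otimes> y"
      using x y z center_comm[OF y z] by (simp add: center_closed m_assoc)
    also have "\<dots> = z \<otimes> (x \<otimes> y)"
      using x y z center_comm[OF x z] by (simp add: center_closed m_assoc)
    finally show ?thesis .
  qed
  then show ?thesis
    using center_closed[OF x] center_closed[OF y] by (simp add: center_def)
qed

text \<open>The product in \<open>H_map\<close> is a \<open>finprod\<close> over the center, whose
  laws are those of a commutative monoid; D itself need not be one.\<close>

lemma center_ring_comm_monoid: "comm_monoid (center_ring R)"
proof (rule comm_monoidI)
  fix x y assume "x \<in> carrier (center_ring R)" "y \<in> carrier (center_ring R)"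
  then show "x \<otimes>\<^bsub>center_ring R\<^esub> y = y \<otimes>\<^bsub>center_ring R\<^esub> x"
    using center_comm center_closed by simp
next
  show "\<one>\<^bsub>center_ring R\<^esub> \<in> carrier (center_ring R)" by (simp add: center_def)
qed (simp_all add: center_mult center_closed m_assoc)

lemma center_ring_monoid: "monoid (center_ring R)"
  using center_ring_comm_monoid comm_monoid.axioms(1) by blast

end

text \<open>\<open>H_map\<close> and \<open>G_map\<close> will be known only on the carrier of A.
  Closure enters because the homomorphism equations evaluate the map at products, sums and scalar
  multiples; A is not an instance of a ring locale, so it is assumed explicitly.\<close>

lemma alg_auts_cong:
  assumes h: "h \<in> alg_auts R M" and eq: "\<And>x. x \<in> carrier M \<Longrightarrow> h' x = h x"
    and closed: "\<And>x y. x \<in> carrier M \<Longrightarrow> y \<in> carrier M \<Longrightarrow> x \<otimes>\<^bsub>M\<^esub> y \<in> carrier M"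
      "\<And>x y. x \<in> carrier M \<Longrightarrow> y \<in> carrier M \<Longrightarrow> x \<oplus>\<^bsub>M\<^esub> y \<in> carrier M"
      "\<one>\<^bsub>M\<^esub> \<in> carrier M"
      "\<And>r x. r \<in> carrier R \<Longrightarrow> x \<in> carrier M \<Longrightarrow> r \<odot>\<^bsub>M\<^esub> x \<in> carrier M"
  shows "h' \<in> alg_auts R M"
proof -
  have "bij_betw h' (carrier M) (carrier M) \<longleftrightarrow> bij_betw h (carrier M) (carrier M)"
    using eq by (rule bij_betw_cong)
  then show ?thesis
    using h eq closed by (auto simp: alg_auts_def ring_iso_def ring_hom_def)
qed

section \<open>Skew polynomials and right division by t^m - d\<close>

locale skew_cyclic = ring D for D (structure) +
  fixes \<sigma> :: "'a \<Rightarrow> 'a" and m :: nat and d :: 'a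
  assumes sigma_hom: "\<sigma> \<in> ring_hom D D"
    and m_pos: "0 < m"
    and d_closed: "d \<in> carrier D"
begin

lemma sigma_pow_hom: "\<sigma> ^^ i \<in> ring_hom D D"
proof (induction i)
  case 0
  then show ?case by (auto simp: ring_hom_def)
next
  case (Suc i)
  then show ?case using ring_hom_trans[OF Suc sigma_hom] by (simp only: funpow.simps)
qed

lemma sigma_pow_closed [simp, intro]: "x \<in> carrier D \<Longrightarrow> (\<sigma> ^^ i) x \<in> carrier D"
  using ring_hom_closed[OF sigma_pow_hom] .

lemma sigma_pow_mult [simp]:
  "x \<in> carrier D \<Longrightarrow> y \<in> carrier D \<Longrightarrow> (\<sigma> ^^ i) (x \<otimes> y) = (\<sigma> ^^ i) x \<otimes> (\<sigma> ^^ i) y"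
  using ring_hom_mult[OF sigma_pow_hom] .

lemma sigma_pow_one [simp]: "(\<sigma> ^^ i) \<one> = \<one>"
  using ring_hom_one[OF sigma_pow_hom] .

lemma sigma_pow_zero [simp]: "(\<sigma> ^^ i) \<zero> = \<zero>"
  using ring_hom_zero[OF sigma_pow_hom] ring_axioms by blast

lemma sigma_pow_a_inv [simp]: "x \<in> carrier D \<Longrightarrow> (\<sigma> ^^ i) (\<ominus> x) = \<ominus> (\<sigma> ^^ i) x"
proof -
  interpret ring_hom_ring D D "\<sigma> ^^ i"
    by unfold_locales (rule sigma_pow_hom)
  show "x \<in> carrier D \<Longrightarrow> (\<sigma> ^^ i) (\<ominus> x) = \<ominus> (\<sigma> ^^ i) x"
    by simp
qed

abbreviation P where "P \<equiv> skew_poly D \<sigma>"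
abbreviation A where "A \<equiv> cyclic_alg D \<sigma> m d"

text \<open>The operations inherited from \<open>UP\<close> are restricted functions, hence the
  membership premises.\<close>

lemma skew_poly_simps:
  "carrier P = up D"
  "p \<in> up D \<Longrightarrow> q \<in> up D \<Longrightarrow> p \<oplus>\<^bsub>P\<^esub> q = (\<lambda>n. p n \<oplus> q n)"
  "a \<in> carrier D \<Longrightarrow> p \<in> up D \<Longrightarrow> a \<odot>\<^bsub>P\<^esub> p = (\<lambda>n. a \<otimes> p n)"
  "p \<in> up D \<Longrightarrow> q \<in> up D \<Longrightarrow>
     p \<otimes>\<^bsub>P\<^esub> q = (\<lambda>n. \<Oplus>i \<in> {..n}. p i \<otimes> (\<sigma> ^^ i) (q (n - i)))"
  "\<one>\<^bsub>P\<^esub> = (\<lambda>n. if n = 0 then \<one> else \<zero>)"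
  by (simp_all add: skew_poly_def UP_def)

lemma bounded_mem_up: "(\<And>n. p n \<in> carrier D) \<Longrightarrow> (\<And>n. N \<le> n \<Longrightarrow> p n = \<zero>) \<Longrightarrow> p \<in> up D"
  by (intro mem_upI exI[of _ N]) auto

lemma const_poly_eq: "a \<in> carrier D \<Longrightarrow> const_poly D a = (\<lambda>n. if n = 0 then a else \<zero>)"
  by (simp add: UP_def)

lemma coeff_UP: "p \<in> carrier (UP D) \<Longrightarrow> coeff (UP D) p = p"
  by (simp add: UP_def)

lemma cyclic_poly_eq:
  "cyclic_poly D \<sigma> m d = (\<lambda>n. if n = m then \<one> else if n = 0 then \<ominus> d else \<zero>)"
proof -
  interpret UP_ring D "UP D" by (intro UP_ring.intro ring_axioms)
  \<comment> \<open>The two records differ only in \<open>mult\<close>, so the difference can be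
    computed in \<open>UP D\<close>, where ring laws are available.\<close>
  have "cyclic_poly D \<sigma> m d = monom (UP D) \<one> m \<ominus>\<^bsub>UP D\<^esub> monom (UP D) d 0"
    by (simp add: cyclic_poly_def skew_poly_def Let_def a_minus_def a_inv_def UP_def)
  also have "\<dots> = (\<lambda>n. if n = m then \<one> else if n = 0 then \<ominus> d else \<zero>)"
  proof
    fix n
    let ?f = "monom (UP D) \<one> m \<ominus>\<^bsub>UP D\<^esub> monom (UP D) d 0"
    have "?f \<in> carrier (UP D)"
      using d_closed unfolding a_minus_def by simp
    then have "?f n = coeff (UP D) ?f n"
      by (simp only: coeff_UP)
    then show "?f n = (if n = m then \<one> else if n = 0 then \<ominus> d else \<zero>)"
      using d_closed m_pos by (simp add: a_minus_def)
  qed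
  finally show ?thesis .
qed

lemma cyclic_poly_up: "cyclic_poly D \<sigma> m d \<in> up D"
  unfolding cyclic_poly_eq using d_closed by (intro bounded_mem_up[of _ "Suc m"]) auto

text \<open>Coefficient form of a t^i (t^m - d) = a t^(i+m) - a \<sigma>^i(d) t^i.\<close>

lemma mult_cyclic_poly:
  assumes q: "q \<in> up D"
  shows "(q \<otimes>\<^bsub>P\<^esub> cyclic_poly D \<sigma> m d) n =
    (if m \<le> n then q (n - m) else \<zero>) \<ominus> q n \<otimes> (\<sigma> ^^ n) d"
proof -
  \<comment> \<open>The convolution has at most two nonzero terms, one for each coefficient of t^m -
    d. The guard \<open>m \<le> n\<close> excludes the truncated case of
    \<open>n - m\<close>.\<close>
  let ?s = "\<lambda>i. if m \<le> n \<and> i = n - m then q i else \<zero>"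
  let ?t = "\<lambda>i. if i = n then \<ominus> (q i \<otimes> (\<sigma> ^^ i) d) else \<zero>"
  have [simp]: "q i \<in> carrier D" for i using q by auto
  note [simp] = d_closed
  have "(q \<otimes>\<^bsub>P\<^esub> cyclic_poly D \<sigma> m d) n =
      (\<Oplus>i \<in> {..n}. q i \<otimes> (\<sigma> ^^ i) (cyclic_poly D \<sigma> m d (n - i)))"
    by (simp add: skew_poly_simps q cyclic_poly_up)
  also have "\<dots> = (\<Oplus>i \<in> {..n}. ?s i \<oplus> ?t i)"
    using m_pos by (intro add.finprod_cong') (auto simp: cyclic_poly_eq r_minus)
  also have "\<dots> = (\<Oplus>i \<in> {..n}. ?s i) \<oplus> (\<Oplus>i \<in> {..n}. ?t i)"
    by (intro finsum_addf) auto
  also have "(\<Oplus>i \<in> {..n}. ?t i) = \<ominus> (q n \<otimes> (\<sigma> ^^ n) d)"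
    by (subst finsum_eq_single[of _ n]) auto
  also have "(\<Oplus>i \<in> {..n}. ?s i) = (if m \<le> n then q (n - m) else \<zero>)"
  proof (cases "m \<le> n")
    case True
    then show ?thesis by (subst finsum_eq_single[of _ "n - m"]) auto
  qed simp
  finally show ?thesis by (simp add: a_minus_def)
qed

text \<open>\<open>deg\<close> assigns 0 to the zero polynomial; since m > 0, the bound m - 1 covers
  that case too.\<close>

lemma deg_less_iff:
  assumes "p \<in> up D"
  shows "deg D p < m \<longleftrightarrow> (\<forall>n\<ge>m. p n = \<zero>)"
proof -
  interpret UP_ring D "UP D" by (intro UP_ring.intro ring_axioms)
  have p: "p \<in> carrier (UP D)" "coeff (UP D) p = p"
    using assms by (auto simp: UP_def)
  show ?thesis
  proof
    assume "deg D p < m"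
    then show "\<forall>n\<ge>m. p n = \<zero>" using deg_aboveD[OF _ p(1)] p(2) by auto
  next
    assume "\<forall>n\<ge>m. p n = \<zero>"
    then have "deg D p \<le> m - 1"
      using m_pos p by (intro deg_aboveI) auto
    then show "deg D p < m" using m_pos by linarith
  qed
qed

lemma carrier_cyclic_alg:
  "g \<in> carrier A \<longleftrightarrow> (\<forall>n. g n \<in> carrier D) \<and> (\<forall>n\<ge>m. g n = \<zero>)"
  unfolding cyclic_alg_def Let_def skew_poly_simps
  using deg_less_iff bounded_mem_up[of g m] by auto

lemma carrier_cyclic_alg_up: "g \<in> carrier A \<Longrightarrow> g \<in> up D"
  by (auto simp: carrier_cyclic_alg intro: bounded_mem_up)

text \<open>
  The quotient is forced from the top down: comparing coefficients at \<open>n \<ge> m\<close> in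
  \<open>p = q f + r\<close> gives \<open>q\<^sub>n\<^sub>-\<^sub>m = p\<^sub>n + q\<^sub>n \<sigma>\<^sup>n(d)\<close>, and \<open>q\<^sub>n = 0\<close> for large \<open>n\<close>.
\<close>

lemma right_rem_unique:
  assumes "q \<in> up D" "q' \<in> up D" "r \<in> carrier A" "r' \<in> carrier A"
    and eq: "q \<otimes>\<^bsub>P\<^esub> cyclic_poly D \<sigma> m d \<oplus>\<^bsub>P\<^esub> r = q' \<otimes>\<^bsub>P\<^esub> cyclic_poly D \<sigma> m d \<oplus>\<^bsub>P\<^esub> r'"
    and up: "q \<otimes>\<^bsub>P\<^esub> cyclic_poly D \<sigma> m d \<in> up D" "q' \<otimes>\<^bsub>P\<^esub> cyclic_poly D \<sigma> m d \<in> up D"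
  shows "r = r'"
proof -
  note [simp] = d_closed
  have [simp]: "q i \<in> carrier D" "q' i \<in> carrier D" "r i \<in> carrier D" "r' i \<in> carrier D" for i
    using assms(1-4) by (auto simp: carrier_cyclic_alg)
  have top: "r n = \<zero>" "r' n = \<zero>" if "m \<le> n" for n
    using that assms(3,4) by (auto simp: carrier_cyclic_alg)
  have coeffs: "((if m \<le> n then q (n - m) else \<zero>) \<ominus> q n \<otimes> (\<sigma> ^^ n) d) \<oplus> r n =
      ((if m \<le> n then q' (n - m) else \<zero>) \<ominus> q' n \<otimes> (\<sigma> ^^ n) d) \<oplus> r' n" for n
    using fun_cong[OF eq, of n] assms(1-4) up
    by (simp add: skew_poly_simps(2) carrier_cyclic_alg_up mult_cyclic_poly)
  obtain N N' where N: "bound \<zero> N q" "bound \<zero> N' q'" using assms(1,2) by blast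
  have "q n = q' n" for n
  \<comment> \<open>Beyond \<open>N + N'\<close> both quotients vanish; below that, m > 0 makes the
    measure drop from n to n + m.\<close>
  proof (induction "N + N' + 1 - n" arbitrary: n rule: less_induct)
    case less
    show ?case
    proof (cases "n < N + N' + 1")
      case True
      then have "q (n + m) = q' (n + m)"
        using m_pos by (intro less) auto
      then show ?thesis
        using coeffs[of "n + m"] top[of "n + m"]
        by (simp add: a_minus_def)
    next
      case False
      then show ?thesis using N by (auto simp: bound_def)
    qed
  qed
  then have "r n = r' n" for n
    using coeffs[of n] top[of n] by (cases "m \<le> n") (auto simp: a_minus_def)
  then show ?thesis by blast
qed

section \<open>Closed form of the multiplication of A\<close>

text \<open>Modulo t^m - d on the right, t^(n+m) becomes t^n d = \<sigma>^n(d) t^n. One such folding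
  yields the remainder when p has no terms of degree 2m or more.\<close>

definition rem :: "(nat \<Rightarrow> 'a) \<Rightarrow> nat \<Rightarrow> 'a"
  where "rem p = (\<lambda>n. if n < m then p n \<oplus> p (n + m) \<otimes> (\<sigma> ^^ n) d else \<zero>)"

lemma right_rem_eq:
  assumes p: "\<And>n. p n \<in> carrier D" and p_top: "\<And>n. 2 * m \<le> n \<Longrightarrow> p n = \<zero>"
  shows "right_rem D \<sigma> m d p = rem p"
proof -
  note [simp] = d_closed p
  let ?f = "cyclic_poly D \<sigma> m d"
  \<comment> \<open>The quotient is the upper half of p shifted down by m.\<close>
  let ?q = "\<lambda>n. if n < m then p (n + m) else \<zero>"
  have q_up: "?q \<in> up D" by (intro bounded_mem_up[of _ m]) auto
  have r: "rem p \<in> carrier A" by (simp add: carrier_cyclic_alg rem_def)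
  \<comment> \<open>Addition is specified on \<open>up D\<close> only, and uniqueness compares with
    an arbitrary quotient q, so every product q f has to be shown to lie there.\<close>
  have mult_up: "q \<otimes>\<^bsub>P\<^esub> ?f \<in> up D" if q: "q \<in> up D" for q
  proof -
    obtain N where N: "bound \<zero> N q" using q by blast
    have [simp]: "q i \<in> carrier D" for i using q by auto
    show ?thesis
    proof (rule bounded_mem_up[of _ "N + m + 1"])
      show "(q \<otimes>\<^bsub>P\<^esub> ?f) n = \<zero>" if "N + m + 1 \<le> n" for n
        using that N by (simp add: mult_cyclic_poly[OF q] bound_def a_minus_def)
    qed (simp add: mult_cyclic_poly[OF q] minus_closed)
  qed
  have div: "p = ?q \<otimes>\<^bsub>P\<^esub> ?f \<oplus>\<^bsub>P\<^esub> rem p"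
  proof
    fix n
    have "(?q \<otimes>\<^bsub>P\<^esub> ?f \<oplus>\<^bsub>P\<^esub> rem p) n =
        ((if m \<le> n then ?q (n - m) else \<zero>) \<ominus> ?q n \<otimes> (\<sigma> ^^ n) d) \<oplus> rem p n"
      by (simp only: skew_poly_simps(2)[OF mult_up[OF q_up] carrier_cyclic_alg_up[OF r]]
          mult_cyclic_poly[OF q_up])
    also have "\<dots> = p n"
    proof (cases "m \<le> n")
      case True
      then show ?thesis using p_top[of n] by (auto simp: rem_def a_minus_def)
    next
      case False
      then show ?thesis by (simp add: rem_def a_minus_def a_lcomm r_neg r_neg1 l_neg)
    qed
    finally show "p n = (?q \<otimes>\<^bsub>P\<^esub> ?f \<oplus>\<^bsub>P\<^esub> rem p) n" by simp
  qed
  have carrier_A: "r \<in> carrier A \<longleftrightarrow> r \<in> carrier P \<and> deg D r < m" for r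
    by (simp add: cyclic_alg_def Let_def)
  show ?thesis
    unfolding right_rem_def Let_def
  proof (rule the_equality)
    show "rem p \<in> carrier P \<and> deg D (rem p) < m \<and>
        (\<exists>q\<in>carrier P. p = q \<otimes>\<^bsub>P\<^esub> ?f \<oplus>\<^bsub>P\<^esub> rem p)"
      using r carrier_A q_up div by (auto simp: skew_poly_simps(1))
  next
    fix r' assume *: "r' \<in> carrier P \<and> deg D r' < m \<and>
        (\<exists>q\<in>carrier P. p = q \<otimes>\<^bsub>P\<^esub> ?f \<oplus>\<^bsub>P\<^esub> r')"
    then obtain q where q: "q \<in> up D" "p = q \<otimes>\<^bsub>P\<^esub> ?f \<oplus>\<^bsub>P\<^esub> r'" by (auto simp: skew_poly_simps(1))
    show "r' = rem p"
    proof (rule right_rem_unique[OF q(1) q_up _ r _ mult_up[OF q(1)] mult_up[OF q_up]])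
      show "r' \<in> carrier A" using * carrier_A by blast
      show "q \<otimes>\<^bsub>P\<^esub> ?f \<oplus>\<^bsub>P\<^esub> r' = ?q \<otimes>\<^bsub>P\<^esub> ?f \<oplus>\<^bsub>P\<^esub> rem p"
        using q(2) div by (rule trans[OF sym])
    qed
  qed
qed

lemma skew_mult_closed:
  "g \<in> carrier A \<Longrightarrow> h \<in> carrier A \<Longrightarrow> (g \<otimes>\<^bsub>P\<^esub> h) n \<in> carrier D"
  by (auto simp: skew_poly_simps(4) carrier_cyclic_alg_up carrier_cyclic_alg intro!: finsum_closed)

lemma cyclic_alg_mult:
  assumes "g \<in> carrier A" "h \<in> carrier A"
  shows "g \<otimes>\<^bsub>A\<^esub> h = rem (g \<otimes>\<^bsub>P\<^esub> h)"
proof -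
  have "(g \<otimes>\<^bsub>P\<^esub> h) n = \<zero>" if "2 * m \<le> n" for n
  proof -
    \<comment> \<open>If i < m, then n - i is at least m, so one factor vanishes.\<close>
    have "g i \<otimes> (\<sigma> ^^ i) (h (n - i)) = \<zero>" if "i \<le> n" for i
      using that \<open>2 * m \<le> n\<close> assms by (cases "m \<le> i") (auto simp: carrier_cyclic_alg)
    then have "(\<Oplus>i\<in>{..n}. g i \<otimes> (\<sigma> ^^ i) (h (n - i))) = (\<Oplus>i\<in>{..n}. \<zero>)"
      by (intro add.finprod_cong') auto
    then show ?thesis using assms by (simp add: skew_poly_simps(4) carrier_cyclic_alg_up)
  qed
  then have "right_rem D \<sigma> m d (g \<otimes>\<^bsub>P\<^esub> h) = rem (g \<otimes>\<^bsub>P\<^esub> h)"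
    using assms by (intro right_rem_eq skew_mult_closed)
  then show ?thesis by (simp add: cyclic_alg_def Let_def)
qed

lemma const_poly_closed: "a \<in> carrier D \<Longrightarrow> const_poly D a \<in> carrier A"
  using m_pos by (simp add: const_poly_eq carrier_cyclic_alg del: restrict_apply)

text \<open>A constant factor keeps the degree below m, so folding changes nothing and d does not
  appear.\<close>

lemma cyclic_alg_const_mult:
  assumes a: "a \<in> carrier D" and g: "g \<in> carrier A"
  shows "const_poly D a \<otimes>\<^bsub>A\<^esub> g = (\<lambda>n. a \<otimes> g n)"
proof -
  have g_closed: "g i \<in> carrier D" for i using g by (simp add: carrier_cyclic_alg)
  have "(const_poly D a \<otimes>\<^bsub>P\<^esub> g) n = a \<otimes> g n" for n
  proof -
    have "(const_poly D a \<otimes>\<^bsub>P\<^esub> g) n =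
        (\<Oplus>i\<in>{..n}. const_poly D a i \<otimes> (\<sigma> ^^ i) (g (n - i)))"
      using a g by (simp only: skew_poly_simps(4) carrier_cyclic_alg_up const_poly_closed)
    also have "\<dots> = const_poly D a 0 \<otimes> (\<sigma> ^^ 0) (g (n - 0))"
      by (rule finsum_eq_single) (simp_all only: const_poly_eq[OF a], simp_all add: a g_closed)
    finally show ?thesis by (simp add: const_poly_eq[OF a] del: restrict_apply)
  qed
  then have "const_poly D a \<otimes>\<^bsub>A\<^esub> g = rem (\<lambda>n. a \<otimes> g n)"
    using cyclic_alg_mult[OF const_poly_closed[OF a] g] by presburger
  also have "\<dots> = (\<lambda>n. a \<otimes> g n)"
    using a g d_closed by (auto simp: rem_def carrier_cyclic_alg)
  finally show ?thesis .
qed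

text \<open>Moving \<open>a\<close> to the left past t^n applies \<sigma>^n; this twist is why
  conjugation by a central unit can be nontrivial.\<close>

lemma cyclic_alg_mult_const:
  assumes a: "a \<in> carrier D" and g: "g \<in> carrier A"
  shows "g \<otimes>\<^bsub>A\<^esub> const_poly D a = (\<lambda>n. g n \<otimes> (\<sigma> ^^ n) a)"
proof -
  have g_closed: "g i \<in> carrier D" for i using g by (simp add: carrier_cyclic_alg)
  have "(g \<otimes>\<^bsub>P\<^esub> const_poly D a) n = g n \<otimes> (\<sigma> ^^ n) a" for n
  proof -
    have "(g \<otimes>\<^bsub>P\<^esub> const_poly D a) n =
        (\<Oplus>i\<in>{..n}. g i \<otimes> (\<sigma> ^^ i) (const_poly D a (n - i)))"
      using a g by (simp only: skew_poly_simps(4) carrier_cyclic_alg_up const_poly_closed)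
    also have "\<dots> = g n \<otimes> (\<sigma> ^^ n) (const_poly D a (n - n))"
      by (rule finsum_eq_single) (simp_all only: const_poly_eq[OF a], simp_all add: a g_closed)
    finally show ?thesis by (simp add: const_poly_eq[OF a] del: restrict_apply)
  qed
  then have "g \<otimes>\<^bsub>A\<^esub> const_poly D a = rem (\<lambda>n. g n \<otimes> (\<sigma> ^^ n) a)"
    using cyclic_alg_mult[OF g const_poly_closed[OF a]] by presburger
  also have "\<dots> = (\<lambda>n. g n \<otimes> (\<sigma> ^^ n) a)"
    using a g d_closed by (auto simp: rem_def carrier_cyclic_alg)
  finally show ?thesis .
qed

lemma cyclic_alg_mult_closed: "g \<in> carrier A \<Longrightarrow> h \<in> carrier A \<Longrightarrow> g \<otimes>\<^bsub>A\<^esub> h \<in> carrier A"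
  using skew_mult_closed d_closed by (simp add: cyclic_alg_mult) (simp add: rem_def carrier_cyclic_alg)

lemma cyclic_alg_add: "g \<in> carrier A \<Longrightarrow> h \<in> carrier A \<Longrightarrow> g \<oplus>\<^bsub>A\<^esub> h = (\<lambda>n. g n \<oplus> h n)"
  using skew_poly_simps(2) carrier_cyclic_alg_up by (simp add: cyclic_alg_def Let_def)

lemma cyclic_alg_add_closed: "g \<in> carrier A \<Longrightarrow> h \<in> carrier A \<Longrightarrow> g \<oplus>\<^bsub>A\<^esub> h \<in> carrier A"
  by (simp add: cyclic_alg_add) (simp add: carrier_cyclic_alg)

lemma cyclic_alg_smult: "r \<in> carrier D \<Longrightarrow> g \<in> carrier A \<Longrightarrow> r \<odot>\<^bsub>A\<^esub> g = (\<lambda>n. r \<otimes> g n)"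
  using skew_poly_simps(3) carrier_cyclic_alg_up by (simp add: cyclic_alg_def Let_def)

lemma cyclic_alg_smult_closed: "r \<in> carrier D \<Longrightarrow> g \<in> carrier A \<Longrightarrow> r \<odot>\<^bsub>A\<^esub> g \<in> carrier A"
  by (simp add: cyclic_alg_smult) (simp add: carrier_cyclic_alg)

lemma cyclic_alg_one: "\<one>\<^bsub>A\<^esub> = (\<lambda>n. if n = 0 then \<one> else \<zero>)"
  by (simp add: cyclic_alg_def Let_def skew_poly_simps)

lemma cyclic_alg_one_closed: "\<one>\<^bsub>A\<^esub> \<in> carrier A"
  using m_pos by (simp add: cyclic_alg_one carrier_cyclic_alg)

end

section \<open>The cocycle of a central unit\<close>

text \<open>
  For a central unit \<open>c\<close> the map \<open>G\<^sub>c\<close> multiplies the coefficient of \<open>t\<^sup>i\<close> by the cocycle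
  \<open>c\<^sup>-\<^sup>1 \<sigma>\<^sup>i(c)\<close>. As \<open>\<sigma>\<^sup>m\<close> fixes \<open>c\<close>, this factor has period \<open>m\<close> in \<open>i\<close>, so that the
  rescaling is compatible with reduction modulo \<open>t\<^sup>m - d\<close>.
\<close>

locale skew_cyclic_unit = skew_cyclic +
  fixes c ci :: 'a
  assumes sigma_surj: "\<sigma> ` carrier D = carrier D"
    and c_center: "c \<in> center D"
    and ci_center: "ci \<in> center D"
    and ci_c: "ci \<otimes> c = \<one>"
    and sigma_m_c: "(\<sigma> ^^ m) c = c"
begin

text \<open>The image of a central element commutes with the image of \<sigma>^i, which is all of D
  by surjectivity.\<close>

lemma sigma_pow_center:
  assumes x: "x \<in> center D"
  shows "(\<sigma> ^^ i) x \<in> center D"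
proof -
  have surj: "(\<sigma> ^^ i) ` carrier D = carrier D"
  proof (induction i)
    case (Suc i)
    then show ?case using sigma_surj by (simp only: funpow.simps image_comp[symmetric])
  qed simp
  have "(\<sigma> ^^ i) x \<otimes> z = z \<otimes> (\<sigma> ^^ i) x" if z: "z \<in> carrier D" for z
  proof -
    obtain y where "y \<in> carrier D" "z = (\<sigma> ^^ i) y" using surj z by blast
    then show ?thesis
      using center_comm[OF x] center_closed[OF x] by (metis sigma_pow_mult)
  qed
  then show ?thesis using center_closed[OF x] by (simp add: center_def)
qed

lemma c_ci_closed [simp]: "c \<in> carrier D" "ci \<in> carrier D"
  using c_center ci_center by (auto dest: center_closed)

lemma c_ci: "c \<otimes> ci = \<one>"
  using ci_c center_comm[OF c_center, of ci] by simp

text \<open>The coboundary of \<open>c\<close>; its value at 1 is the k of the theorem.\<close>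

definition u where "u i = ci \<otimes> (\<sigma> ^^ i) c"

lemma u_center: "u i \<in> center D"
  by (simp add: u_def center_mult ci_center sigma_pow_center c_center)

lemma u_closed [simp]: "u i \<in> carrier D"
  by (simp add: u_def)

lemma u_0 [simp]: "u 0 = \<one>"
  by (simp add: u_def ci_c)

text \<open>In c^(-1) \<sigma>^i(c) \<sigma>^i(c^(-1)) \<sigma>^(i+l)(c) the two middle factors
  cancel.\<close>

lemma u_add: "u (i + l) = u i \<otimes> (\<sigma> ^^ i) (u l)"
proof -
  have "u i \<otimes> (\<sigma> ^^ i) (u l) = ci \<otimes> ((\<sigma> ^^ i) (c \<otimes> ci) \<otimes> (\<sigma> ^^ i) ((\<sigma> ^^ l) c))"
    by (simp add: u_def m_assoc)
  also have "\<dots> = u (i + l)"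
    by (simp add: c_ci u_def funpow_add)
  finally show ?thesis by simp
qed

lemma u_add_m: "u (i + m) = u i"
  by (simp add: u_def funpow_add sigma_m_c)

lemma u_inv: "u i \<otimes> (\<sigma> ^^ i) ci \<otimes> c = \<one>"
proof -
  have "u i \<otimes> (\<sigma> ^^ i) ci = ci \<otimes> (\<sigma> ^^ i) (c \<otimes> ci)"
    by (simp add: u_def m_assoc)
  then show ?thesis by (simp add: c_ci ci_c)
qed

text \<open>The product telescopes; inductively, this is the cocycle identity with second index
  1.\<close>

lemma finprod_cocycle:
  "(\<Otimes>\<^bsub>center_ring D\<^esub>l\<in>{..<i}. (\<sigma> ^^ l) (ci \<otimes> \<sigma> c)) = u i"
proof (induction i)
  case 0
  then show ?case by (simp add: comm_monoid.finprod_empty[OF center_ring_comm_monoid])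
next
  case (Suc i)
  have u1: "ci \<otimes> \<sigma> c = u 1" by (simp add: u_def)
  have "(\<Otimes>\<^bsub>center_ring D\<^esub>l\<in>insert i {..<i}. (\<sigma> ^^ l) (u 1)) =
      (\<sigma> ^^ i) (u 1) \<otimes> (\<Otimes>\<^bsub>center_ring D\<^esub>l\<in>{..<i}. (\<sigma> ^^ l) (u 1))"
    by (subst comm_monoid.finprod_insert[OF center_ring_comm_monoid])
      (auto simp: sigma_pow_center u_center)
  also have "\<dots> = u i \<otimes> (\<sigma> ^^ i) (u 1)"
    using Suc by (simp add: u1 center_comm[OF u_center])
  finally show ?case
    using u_add[of i 1] by (simp add: u1 lessThan_Suc)
qed

lemma finprod_ones: "(\<Otimes>\<^bsub>center_ring D\<^esub>l\<in>{..<i}. (\<sigma> ^^ l) \<one>) = \<one>"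
  using comm_monoid.finprod_one[OF center_ring_comm_monoid] by simp

section \<open>\<open>H_map\<close> and \<open>G_map\<close> on coefficients\<close>

text \<open>The separate case i = 0 of \<open>H_map\<close> is absorbed since \<open>u 0\<close> is
  1. The cutoff at m stays, as \<tau> is just a map here and its value at zero is unknown.\<close>

lemma H_map_eq:
  assumes "\<tau> \<in> carrier D \<rightarrow> carrier D" "g \<in> carrier A"
  shows "H_map D \<sigma> m \<tau> (ci \<otimes> \<sigma> c) g = (\<lambda>i. if i < m then \<tau> (g i) \<otimes> u i else \<zero>)"
proof -
  have "\<tau> (g i) \<in> carrier D" for i using assms by (auto simp: carrier_cyclic_alg)
  then show ?thesis
    using m_pos by (auto simp: H_map_def finprod_cocycle)
qed

lemma H_map_one_eq:
  assumes "\<tau> \<in> carrier D \<rightarrow> carrier D" "g \<in> carrier A"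
  shows "H_map D \<sigma> m \<tau> \<one> g = (\<lambda>i. if i < m then \<tau> (g i) else \<zero>)"
proof -
  have "\<tau> (g i) \<in> carrier D" for i using assms by (auto simp: carrier_cyclic_alg)
  then show ?thesis
    unfolding H_map_def finprod_ones using m_pos by auto
qed

lemma left_inverse_const: "left_inverse A (const_poly D ci) (const_poly D c)"
proof -
  have "const_poly D ci \<otimes>\<^bsub>A\<^esub> const_poly D c = \<one>\<^bsub>A\<^esub>"
    unfolding cyclic_alg_const_mult[OF c_ci_closed(2) const_poly_closed[OF c_ci_closed(1)]]
    by (auto simp: const_poly_eq ci_c cyclic_alg_one simp del: restrict_apply)
  then show ?thesis by (simp add: left_inverse_def const_poly_closed)
qed

text \<open>The coefficient of (c^(-1) g) c at t^i is c^(-1) g_i \<sigma>^i(c), and the central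
  c^(-1) moves past g_i.\<close>

lemma G_map_eq:
  assumes g: "g \<in> carrier A"
  shows "G_map A (const_poly D ci) (const_poly D c) g = (\<lambda>i. g i \<otimes> u i)"
proof -
  have [simp]: "g i \<in> carrier D" for i using g by (simp add: carrier_cyclic_alg)
  have "(\<lambda>n. ci \<otimes> g n) \<in> carrier A"
    using g by (simp add: carrier_cyclic_alg)
  then have "G_map A (const_poly D ci) (const_poly D c) g = (\<lambda>i. ci \<otimes> g i \<otimes> (\<sigma> ^^ i) c)"
    using g by (simp add: G_map_def cyclic_alg_const_mult cyclic_alg_mult_const)
  also have "\<dots> = (\<lambda>i. g i \<otimes> u i)"
    by (simp add: center_comm[OF ci_center] u_def m_assoc)
  finally show ?thesis .
qed

lemma H_map_eq_G_map:
  assumes \<tau>: "\<tau> \<in> carrier D \<rightarrow> carrier D" and g: "g \<in> carrier A"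
  shows "H_map D \<sigma> m \<tau> (ci \<otimes> \<sigma> c) g =
    G_map A (const_poly D ci) (const_poly D c) (H_map D \<sigma> m \<tau> \<one> g)"
proof -
  have "H_map D \<sigma> m \<tau> \<one> g \<in> carrier A"
    using assms by (auto simp: H_map_one_eq carrier_cyclic_alg)
  then show ?thesis
    using assms by (auto simp: G_map_eq H_map_one_eq H_map_eq)
qed

section \<open>Rescaling by the cocycle is an automorphism of A\<close>

text \<open>The common value on A of \<open>H_map\<close> at \<open>id\<close> and of
  \<open>G_map\<close>, so that the automorphism property is proved once for both.\<close>

definition rescale :: "(nat \<Rightarrow> 'a) \<Rightarrow> nat \<Rightarrow> 'a"
  where "rescale g = (\<lambda>i. g i \<otimes> u i)"

lemma rescale_closed: "g \<in> carrier A \<Longrightarrow> rescale g \<in> carrier A"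
  by (simp add: rescale_def carrier_cyclic_alg)

lemma bij_rescale: "bij_betw rescale (carrier A) (carrier A)"
proof -
  \<comment> \<open>The inverse \<sigma>^i(c^(-1)) c of \<open>u i\<close>.\<close>
  let ?w = "\<lambda>i. (\<sigma> ^^ i) ci \<otimes> c"
  have uw: "u i \<otimes> ?w i = \<one>" "?w i \<otimes> u i = \<one>" for i
    using u_inv[of i] center_comm[OF u_center, of "?w i" i] by (simp_all add: m_assoc)
  show ?thesis
  proof (rule bij_betw_byWitness[where f' = "\<lambda>g i. g i \<otimes> ?w i"])
    show "\<forall>g\<in>carrier A. (\<lambda>i. rescale g i \<otimes> ?w i) = g"
      "\<forall>g\<in>carrier A. rescale (\<lambda>i. g i \<otimes> ?w i) = g"
      using uw by (auto simp: rescale_def carrier_cyclic_alg m_assoc simp del: m_assoc)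
        (simp_all add: m_assoc uw)
    show "rescale ` carrier A \<subseteq> carrier A" using rescale_closed by blast
    show "(\<lambda>g i. g i \<otimes> ?w i) ` carrier A \<subseteq> carrier A"
      by (auto simp: carrier_cyclic_alg)
  qed
qed

text \<open>In each term \<open>u i\<close> moves past \<sigma>^i(h_(n-i)) by centrality and
  combines with \<sigma>^i(u_(n-i)) to \<open>u n\<close>, independently of i.\<close>

lemma rescale_skew_mult:
  assumes g: "g \<in> carrier A" and h: "h \<in> carrier A"
  shows "(rescale g \<otimes>\<^bsub>P\<^esub> rescale h) n = (g \<otimes>\<^bsub>P\<^esub> h) n \<otimes> u n"
proof -
  have [simp]: "g i \<in> carrier D" "h i \<in> carrier D" for i
    using g h by (auto simp: carrier_cyclic_alg)
  have "g i \<otimes> u i \<otimes> (\<sigma> ^^ i) (h (n - i) \<otimes> u (n - i)) = g i \<otimes> (\<sigma> ^^ i) (h (n - i)) \<otimes> u n"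
    if "i \<le> n" for i
  proof -
    have "g i \<otimes> u i \<otimes> (\<sigma> ^^ i) (h (n - i) \<otimes> u (n - i)) =
        g i \<otimes> ((u i \<otimes> (\<sigma> ^^ i) (h (n - i))) \<otimes> (\<sigma> ^^ i) (u (n - i)))"
      by (simp add: m_assoc)
    also have "u i \<otimes> (\<sigma> ^^ i) (h (n - i)) = (\<sigma> ^^ i) (h (n - i)) \<otimes> u i"
      by (simp add: center_comm[OF u_center])
    finally show ?thesis
      using u_add[of i "n - i"] that by (simp add: m_assoc)
  qed
  then have "(rescale g \<otimes>\<^bsub>P\<^esub> rescale h) n = (\<Oplus>i\<in>{..n}. g i \<otimes> (\<sigma> ^^ i) (h (n - i)) \<otimes> u n)"
    using rescale_closed[OF g] rescale_closed[OF h]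
    by (auto simp: skew_poly_simps(4) carrier_cyclic_alg_up rescale_def intro!: add.finprod_cong')
  also have "\<dots> = (g \<otimes>\<^bsub>P\<^esub> h) n \<otimes> u n"
    using g h by (simp add: skew_poly_simps(4) carrier_cyclic_alg_up finsum_ldistr Pi_def)
  finally show ?thesis .
qed

text \<open>The folded term p_(n+m) \<sigma>^n(d) is scaled by \<open>u n\<close> if reduced first
  and by \<open>u (n + m)\<close> if rescaled first; the period m makes these equal.\<close>

lemma rescale_mult:
  assumes g: "g \<in> carrier A" and h: "h \<in> carrier A"
  shows "rescale (g \<otimes>\<^bsub>A\<^esub> h) = rescale g \<otimes>\<^bsub>A\<^esub> rescale h"
proof -
  let ?p = "g \<otimes>\<^bsub>P\<^esub> h"
  have [simp]: "?p n \<in> carrier D" for n using skew_mult_closed g h .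
  have "?p (n + m) \<otimes> (\<sigma> ^^ n) d \<otimes> u n = ?p (n + m) \<otimes> u (n + m) \<otimes> (\<sigma> ^^ n) d" for n
    using d_closed by (simp add: m_assoc u_add_m center_comm[OF u_center])
  then have "rescale (rem ?p) = rem (rescale g \<otimes>\<^bsub>P\<^esub> rescale h)"
    using d_closed unfolding rem_def rescale_skew_mult[OF g h]
    unfolding rescale_def by (auto simp: l_distr)
  then show ?thesis
    using g h by (simp add: cyclic_alg_mult rescale_closed)
qed

lemma rescale_aut: "rescale \<in> alg_auts (base_ring D \<sigma>) A"
proof -
  have "rescale \<in> ring_hom A A"
  proof (rule ring_hom_memI)
    fix g h assume gh: "g \<in> carrier A" "h \<in> carrier A"
    then show "rescale g \<in> carrier A" "rescale (g \<otimes>\<^bsub>A\<^esub> h) = rescale g \<otimes>\<^bsub>A\<^esub> rescale h"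
      by (auto simp: rescale_closed rescale_mult)
    show "rescale (g \<oplus>\<^bsub>A\<^esub> h) = rescale g \<oplus>\<^bsub>A\<^esub> rescale h"
      using gh rescale_closed
      by (simp add: cyclic_alg_add) (simp add: rescale_def l_distr carrier_cyclic_alg)
  next
    show "rescale \<one>\<^bsub>A\<^esub> = \<one>\<^bsub>A\<^esub>"
      by (auto simp: cyclic_alg_one rescale_def)
  qed
  \<comment> \<open>Scalars multiply from the left and \<open>u\<close> from the right, so linearity
    is associativity in D.\<close>
  moreover have "rescale (r \<odot>\<^bsub>A\<^esub> g) = r \<odot>\<^bsub>A\<^esub> rescale g"
    if "r \<in> carrier (base_ring D \<sigma>)" "g \<in> carrier A" for r g
    using that rescale_closed center_closed
    by (simp add: cyclic_alg_smult) (simp add: rescale_def carrier_cyclic_alg m_assoc)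
  ultimately show ?thesis
    using bij_rescale by (auto simp: alg_auts_def ring_iso_def)
qed

lemma eq_rescale_aut:
  assumes "\<And>g. g \<in> carrier A \<Longrightarrow> h g = rescale g"
  shows "h \<in> alg_auts (base_ring D \<sigma>) A"
proof (rule alg_auts_cong[OF rescale_aut assms])
  show "r \<odot>\<^bsub>A\<^esub> g \<in> carrier A" if "r \<in> carrier (base_ring D \<sigma>)" "g \<in> carrier A" for r g
    using that cyclic_alg_smult_closed center_closed by simp
qed (use cyclic_alg_mult_closed cyclic_alg_add_closed cyclic_alg_one_closed in auto)

text \<open>The conclusion is shaped like the theorem so that both of its halves are
  instances.\<close>

lemma H_map_inner:
  defines "c' \<equiv> const_poly D ci" and "c'' \<equiv> const_poly D c" and "k \<equiv> ci \<otimes> \<sigma> c"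
  shows "left_inverse A c' c'' \<and>
    (\<forall>\<tau> \<in> alg_auts (base_ring D \<sigma>) (self_alg D). (\<forall>x \<in> carrier D. \<tau> (\<sigma> x) = \<sigma> (\<tau> x)) \<longrightarrow>
      (\<forall>g \<in> carrier A. H_map D \<sigma> m \<tau> k g = (G_map A c' c'' \<circ> H_map D \<sigma> m \<tau> \<one>) g)) \<and>
    H_map D \<sigma> m id k \<in> alg_auts (base_ring D \<sigma>) A \<and>
    G_map A c' c'' \<in> inner_auts (base_ring D \<sigma>) A \<and>
    (\<forall>g \<in> carrier A. H_map D \<sigma> m id k g = G_map A c' c'' g \<and>
      G_map A c' c'' g = (c' \<otimes>\<^bsub>A\<^esub> g) \<otimes>\<^bsub>A\<^esub> c'')"
proof -
  have H: "H_map D \<sigma> m id k g = rescale g" if "g \<in> carrier A" for g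
    using that by (auto simp: k_def H_map_eq rescale_def carrier_cyclic_alg)
  have G: "G_map A c' c'' g = rescale g" if "g \<in> carrier A" for g
    using that by (simp add: c'_def c''_def G_map_eq rescale_def)
  have "\<tau> \<in> carrier D \<rightarrow> carrier D" if "\<tau> \<in> alg_auts (base_ring D \<sigma>) (self_alg D)" for \<tau>
    using that by (simp add: alg_auts_def ring_iso_def ring_hom_def self_alg_def)
  then have "H_map D \<sigma> m \<tau> k g = G_map A c' c'' (H_map D \<sigma> m \<tau> \<one> g)"
    if "\<tau> \<in> alg_auts (base_ring D \<sigma>) (self_alg D)" "g \<in> carrier A" for \<tau> g
    using that H_map_eq_G_map by (simp add: c'_def c''_def k_def)
  moreover have "left_inverse A c' c''"
    unfolding c'_def c''_def by (rule left_inverse_const)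
  moreover from this have "G_map A c' c'' \<in> inner_auts (base_ring D \<sigma>) A"
    using eq_rescale_aut[OF G] unfolding inner_auts_def by blast
  ultimately show ?thesis
    using eq_rescale_aut[OF H] H G by (simp add: G_map_def)
qed

end

section \<open>Specialization to the Azumaya and the commutative setting\<close>

theorem theorem16:
  fixes D :: "('a, 'e) ring_scheme" and \<sigma> :: "'a \<Rightarrow> 'a" and m :: nat and d k c :: 'a
    and S :: "('b, 'f) ring_scheme" and \<rho> :: "'b \<Rightarrow> 'b" and n :: nat and e j b :: 'b
  defines "A \<equiv> cyclic_alg D \<sigma> m d"
    and "S\<^sub>0 \<equiv> base_ring D \<sigma>"
    and "B \<equiv> cyclic_alg S \<rho> n e"
    and "R\<^sub>0 \<equiv> S\<lparr>carrier := fixed S \<rho>\<rparr>"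
  shows "(gen_cyclic_setting D \<sigma> m \<and> d \<in> Units D \<and> k \<in> center D \<and>
      c \<in> Units (center_ring D) \<and> k = inv\<^bsub>center_ring D\<^esub> c \<otimes>\<^bsub>D\<^esub> \<sigma> c \<longrightarrow>
      (let c' = const_poly D (inv\<^bsub>center_ring D\<^esub> c); c'' = const_poly D c in
        left_inverse A c' c'' \<and>
        (\<forall>\<tau> \<in> alg_auts S\<^sub>0 (self_alg D). (\<forall>x \<in> carrier D. \<tau> (\<sigma> x) = \<sigma> (\<tau> x)) \<longrightarrow>
          (\<forall>g \<in> carrier A. H_map D \<sigma> m \<tau> k g = (G_map A c' c'' \<circ> H_map D \<sigma> m \<tau> \<one>\<^bsub>D\<^esub>) g)) \<and>
        H_map D \<sigma> m id k \<in> alg_auts S\<^sub>0 A \<and>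
        G_map A c' c'' \<in> inner_auts S\<^sub>0 A \<and>
        (\<forall>g \<in> carrier A. H_map D \<sigma> m id k g = G_map A c' c'' g \<and>
           G_map A c' c'' g = (c' \<otimes>\<^bsub>A\<^esub> g) \<otimes>\<^bsub>A\<^esub> c'')))
    \<and> (cyclic_setting S \<rho> n \<and> e \<in> Units S \<and> j \<in> carrier S \<and>
      b \<in> Units S \<and> j = inv\<^bsub>S\<^esub> b \<otimes>\<^bsub>S\<^esub> \<rho> b \<longrightarrow>
      (let b' = const_poly S (inv\<^bsub>S\<^esub> b); b'' = const_poly S b in
        left_inverse B b' b'' \<and>
        (\<forall>\<tau> \<in> alg_auts R\<^sub>0 (self_alg S). (\<forall>x \<in> carrier S. \<tau> (\<rho> x) = \<rho> (\<tau> x)) \<longrightarrow>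
          (\<forall>g \<in> carrier B. H_map S \<rho> n \<tau> j g = (G_map B b' b'' \<circ> H_map S \<rho> n \<tau> \<one>\<^bsub>S\<^esub>) g)) \<and>
        H_map S \<rho> n id j \<in> alg_auts R\<^sub>0 B \<and>
        G_map B b' b'' \<in> inner_auts R\<^sub>0 B \<and>
        (\<forall>g \<in> carrier B. H_map S \<rho> n id j g = G_map B b' b'' g \<and>
           G_map B b' b'' g = (b' \<otimes>\<^bsub>B\<^esub> g) \<otimes>\<^bsub>B\<^esub> b'')))"
proof (intro conjI impI)
  assume asm: "gen_cyclic_setting D \<sigma> m \<and> d \<in> Units D \<and> k \<in> center D \<and>
    c \<in> Units (center_ring D) \<and> k = inv\<^bsub>center_ring D\<^esub> c \<otimes>\<^bsub>D\<^esub> \<sigma> c"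
  let ?ci = "inv\<^bsub>center_ring D\<^esub> c"
  have ring: "ring D" and hom: "\<sigma> \<in> ring_iso D D" and m: "2 \<le> m"
    and fix_m: "\<forall>x \<in> center D. (\<sigma> ^^ m) x = x"
    using asm by (auto simp: gen_cyclic_setting_def azumaya_def restricted_order_def)
  interpret D: ring D by (rule ring)
  \<comment> \<open>Taking the inverse of c inside the center makes it central.\<close>
  interpret Z: monoid "center_ring D" by (rule D.center_ring_monoid)
  have ci: "?ci \<in> center D" "c \<in> center D" "?ci \<otimes>\<^bsub>D\<^esub> c = \<one>\<^bsub>D\<^esub>"
    using asm Z.Units_inv_closed[of c] Z.Units_closed[of c] Z.Units_l_inv[of c] by simp_all
  interpret skew_cyclic_unit D \<sigma> m d c ?ci
    using asm hom m fix_m ci by unfold_locales (auto simp: ring_iso_def bij_betw_def)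
  show "let c' = const_poly D ?ci; c'' = const_poly D c in
        left_inverse A c' c'' \<and>
        (\<forall>\<tau> \<in> alg_auts S\<^sub>0 (self_alg D). (\<forall>x \<in> carrier D. \<tau> (\<sigma> x) = \<sigma> (\<tau> x)) \<longrightarrow>
          (\<forall>g \<in> carrier A. H_map D \<sigma> m \<tau> k g = (G_map A c' c'' \<circ> H_map D \<sigma> m \<tau> \<one>\<^bsub>D\<^esub>) g)) \<and>
        H_map D \<sigma> m id k \<in> alg_auts S\<^sub>0 A \<and>
        G_map A c' c'' \<in> inner_auts S\<^sub>0 A \<and>
        (\<forall>g \<in> carrier A. H_map D \<sigma> m id k g = G_map A c' c'' g \<and>
           G_map A c' c'' g = (c' \<otimes>\<^bsub>A\<^esub> g) \<otimes>\<^bsub>A\<^esub> c'')"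
    using H_map_inner asm unfolding Let_def A_def S\<^sub>0_def by metis
next
  assume asm: "cyclic_setting S \<rho> n \<and> e \<in> Units S \<and> j \<in> carrier S \<and>
    b \<in> Units S \<and> j = inv\<^bsub>S\<^esub> b \<otimes>\<^bsub>S\<^esub> \<rho> b"
  let ?bi = "inv\<^bsub>S\<^esub> b"
  have cring: "cring S" and hom: "\<rho> \<in> ring_iso S S" and n: "2 \<le> n"
    and fix_n: "\<forall>x \<in> carrier S. (\<rho> ^^ n) x = x"
    using asm by (auto simp: cyclic_setting_def restricted_order_def)
  interpret S: cring S by (rule cring)
  have center: "center S = carrier S"
    by (auto simp: center_def S.m_comm)
  \<comment> \<open>Since S is its own center, intersecting the fixed ring with it changes
    nothing.\<close>
  have R\<^sub>0: "R\<^sub>0 = base_ring S \<rho>"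
    unfolding R\<^sub>0_def center by (simp add: fixed_def Collect_conj_eq Int_ac)
  interpret skew_cyclic_unit S \<rho> n e b ?bi
    using asm hom n fix_n by unfold_locales (auto simp: center ring_iso_def bij_betw_def)
  show "let b' = const_poly S ?bi; b'' = const_poly S b in
        left_inverse B b' b'' \<and>
        (\<forall>\<tau> \<in> alg_auts R\<^sub>0 (self_alg S). (\<forall>x \<in> carrier S. \<tau> (\<rho> x) = \<rho> (\<tau> x)) \<longrightarrow>
          (\<forall>g \<in> carrier B. H_map S \<rho> n \<tau> j g = (G_map B b' b'' \<circ> H_map S \<rho> n \<tau> \<one>\<^bsub>S\<^esub>) g)) \<and>
        H_map S \<rho> n id j \<in> alg_auts R\<^sub>0 B \<and>
        G_map B b' b'' \<in> inner_auts R\<^sub>0 B \<and>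
        (\<forall>g \<in> carrier B. H_map S \<rho> n id j g = G_map B b' b'' g \<and>
           G_map B b' b'' g = (b' \<otimes>\<^bsub>B\<^esub> g) \<otimes>\<^bsub>B\<^esub> b'')"
    using H_map_inner asm unfolding Let_def B_def R\<^sub>0 by metis
qed

end
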